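(* Let $\Gamma$ be an infinite abelian group and $F\colon\Gamma\to\Gamma$ an injective endomorphism, and suppose $\Gamma/F\Gamma$ is finite. The following are equivalent: (1) there is $r>0$ such that $\Gamma$ admits an $F^r$-spanning set; (2) there is $r>0$ such that there is a length function for $(\Gamma,F^r)$; (3) there is $r>0$ such that there is a height function for $(\Gamma,F^r)$.
   Context: For a string $\sigma=s_0s_1\cdots s_n$ of elements of $\Gamma$ and an endomorphism $G$ of $\Gamma$, write $[\sigma]_G=s_0+Gs_1+\cdots+G^ns_n$ (the empty string gives $0$). For a finite set $\Lambda$, $\Lambda^*$ is the set of finite strings over $\Lambda$. A finite set $\Sigma\subseteq\Gamma$ is a $G$-spanning set if: (i) every $a\in\Gamma$ equals $[\sigma]_G$ for some $\sigma\in\Sigma^*$; (ii) $0\in\Sigma$ and $a\in\Sigma\Rightarrow -a\in\Sigma$; (iii) if $a_1,\dots,a_5\in\Sigma$ then $a_1+\cdots+a_5\in\Sigma+G\Sigma$; (iv) if $a_1,a_2,a_3\in\Sigma$ and $a_1+a_2+a_3\in G\Gamma$ then $a_1+a_2+a_3\in G\Sigma$. A length function for $(\Gamma,G)$ is a map $\lambda\colon\Gamma\to\mathbb{R}_{\ge0}$ such that: $\lambda(a)=\lambda(-a)$ for all $a$; there is $D\ge1$ with $\lambda(a+b)\le D\max(\lambda(a),\lambda(b))$ for all $a,b$; for every $N\in\mathbb{N}$ only finitely many $a$ satisfy $\lambda(a)\le N$; and there are a finite set $A\subseteq\Gamma$ and reals $C>1$, $E\ge1$ with $\lambda(Ga)\le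 C\lambda(a)$ for all $a\in\Gamma$ and $\lambda(G^na)\ge \frac{C^n}{E}\lambda(a)$ for all $a\in\Gamma\setminus A$ and $n\in\mathbb{N}$. A height function for $(\Gamma,G)$ is a map $h\colon\Gamma\to\mathbb{R}_{\ge0}$ such that: there are reals $\alpha>1$ and $\kappa>0$ with $h(-a)\le\alpha h(a)+\kappa$ and $h(a+b)\le\alpha(h(a)+h(b))+\kappa$ for all $a,b\in\Gamma$; for every $N\in\mathbb{N}$ only finitely many $a$ satisfy $h(a)\le N$; and there is $\beta>1$ with $h(Ga)>\beta h(a)$ for all but finitely many $a\in\Gamma$. *)

theory Defs
  imports Complex_Main
begin

definition string_value :: "('a::ab_group_add \<Rightarrow> 'a) \<Rightarrow> 'a list \<Rightarrow> 'a" where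
  "string_value G \<sigma> = (\<Sum>i<length \<sigma>. (G ^^ i) (\<sigma> ! i))"

definition spanning_set :: "('a::ab_group_add \<Rightarrow> 'a) \<Rightarrow> 'a set \<Rightarrow> bool" where
  "spanning_set G S \<longleftrightarrow>
     finite S \<and>
     (\<forall>a. \<exists>\<sigma>\<in>lists S. a = string_value G \<sigma>) \<and>
     0 \<in> S \<and> (\<forall>a\<in>S. - a \<in> S) \<and>
     (\<forall>a1\<in>S. \<forall>a2\<in>S. \<forall>a3\<in>S. \<forall>a4\<in>S. \<forall>a5\<in>S.
        \<exists>b\<in>S. \<exists>c\<in>S. a1 + a2 + a3 + a4 + a5 = b + G c) \<and>
     (\<forall>a1\<in>S. \<forall>a2\<in>S. \<forall>a3\<in>S.
        a1 + a2 + a3 \<in> range G \<longrightarrow> a1 + a2 + a3 \<in> G ` S)"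

definition length_function :: "('a::ab_group_add \<Rightarrow> 'a) \<Rightarrow> ('a \<Rightarrow> real) \<Rightarrow> bool" where
  "length_function G l \<longleftrightarrow>
     (\<forall>a. 0 \<le> l a) \<and>
     (\<forall>a. l a = l (- a)) \<and>
     (\<exists>D\<ge>1. \<forall>a b. l (a + b) \<le> D * max (l a) (l b)) \<and>
     (\<forall>N::nat. finite {a. l a \<le> real N}) \<and>
     (\<exists>A C E. finite A \<and> C > 1 \<and> E \<ge> 1 \<and>
        (\<forall>a. l (G a) \<le> C * l a) \<and>
        (\<forall>a. a \<notin> A \<longrightarrow> (\<forall>n::nat. l ((G ^^ n) a) \<ge> C ^ n / E * l a)))"

definition height_function :: "('a::ab_group_add \<Rightarrow> 'a) \<Rightarrow> ('a \<Rightarrow> real) \<Rightarrow> bool" where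
  "height_function G h \<longleftrightarrow>
     (\<forall>a. 0 \<le> h a) \<and>
     (\<exists>\<alpha>>1. \<exists>\<kappa>>0.
        (\<forall>a. h (- a) \<le> \<alpha> * h a + \<kappa>) \<and>
        (\<forall>a b. h (a + b) \<le> \<alpha> * (h a + h b) + \<kappa>)) \<and>
     (\<forall>N::nat. finite {a. h a \<le> real N}) \<and>
     (\<exists>\<beta>>1. finite {a. \<not> h (G a) > \<beta> * h a})"

end

theory Submission
  imports Defs
begin

text \<open>
  Over a spanning set, \<open>2\<close> to the least length of a string representing \<open>a\<close> is a length
  function: carrying shows that adding costs at most one more digit, and condition (iv) lets one
  divide by \<open>G ^^ n\<close> by cancelling the first \<open>n\<close> digits, again with a single carry.
  A length function for \<open>G\<close> is a height function for a power of \<open>G\<close> large enough to absorb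
  the constant \<open>E\<close>.  Conversely, given a height function, a power \<open>H\<close> of \<open>G\<close> expands heights by
  more than the sums of five elements do, outside a finite set.  Then a sufficiently large
  sublevel set contains representatives of all cosets of the image of \<open>H\<close> and is an
  \<open>H\<close>-spanning set.
\<close>

section \<open>Additive maps and values of digit strings\<close>

lemma additive_funpow:
  fixes F :: "'a::ab_group_add \<Rightarrow> 'a"
  assumes "additive F"
  shows "additive (F ^^ n)"
  using assms by (induction n) (auto simp: additive_def)

lemma string_value_Nil [simp]: "string_value G [] = 0"
  by (simp add: string_value_def)

lemma string_value_Cons:
  assumes "additive G"
  shows "string_value G (s # \<sigma>) = s + G (string_value G \<sigma>)"
  by (simp add: string_value_def additive.sum[OF assms] sum.lessThan_Suc_shift del: sum.lessThan_Suc)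

text \<open>The length is exact so that membership unfolds one first digit at a time. For additive
  \<open>G\<close> and \<open>0 \<in> S\<close>, padding makes these sets increase with
  \<open>n\<close>.\<close>

definition values_of_length :: "('a::ab_group_add \<Rightarrow> 'a) \<Rightarrow> 'a set \<Rightarrow> nat \<Rightarrow> 'a set" where
  "values_of_length G S n = string_value G ` {\<sigma>. set \<sigma> \<subseteq> S \<and> length \<sigma> = n}"

lemma values_of_length_0 [simp]: "values_of_length G S 0 = {0}"
  by (auto simp: values_of_length_def image_iff)

lemma values_of_length_Suc:
  assumes "additive G"
  shows "v \<in> values_of_length G S (Suc n) \<longleftrightarrow> (\<exists>s\<in>S. \<exists>u\<in>values_of_length G S n. v = s + G u)"
proof
  assume "v \<in> values_of_length G S (Suc n)"
  then obtain s \<sigma> where "v = string_value G (s # \<sigma>)" "s \<in> S" "set \<sigma> \<subseteq> S" "length \<sigma> = n"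
    by (auto simp: values_of_length_def length_Suc_conv)
  then show "\<exists>s\<in>S. \<exists>u\<in>values_of_length G S n. v = s + G u"
    by (auto simp: values_of_length_def string_value_Cons[OF assms])
next
  assume "\<exists>s\<in>S. \<exists>u\<in>values_of_length G S n. v = s + G u"
  then obtain s \<sigma> where "v = s + G (string_value G \<sigma>)" "s \<in> S" "set \<sigma> \<subseteq> S" "length \<sigma> = n"
    by (auto simp: values_of_length_def)
  then show "v \<in> values_of_length G S (Suc n)"
    unfolding values_of_length_def
    by (intro image_eqI[of _ _ "s # \<sigma>"]) (auto simp: string_value_Cons[OF assms])
qed

section \<open>From spanning sets to length functions: digit arithmetic with carries\<close>

context
  fixes G :: "'a::ab_group_add \<Rightarrow> 'a" and S :: "'a set"
  assumes additive: "additive G" and inj: "inj G" and spanning: "spanning_set G S"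
begin

interpretation additive G by (fact additive)

abbreviation (input) "V \<equiv> values_of_length G S"

lemma S_zero: "0 \<in> S" and S_uminus: "a \<in> S \<Longrightarrow> - a \<in> S"
  using spanning by (auto simp: spanning_set_def)

text \<open>The rule for column addition: two digits and an incoming carry leave a digit and an
  outgoing carry. It is the five-term condition with two summands 0.\<close>

lemma S_add3:
  assumes "a \<in> S" "b \<in> S" "c \<in> S"
  shows "\<exists>d\<in>S. \<exists>e\<in>S. a + b + c = d + G e"
proof -
  have "\<exists>d\<in>S. \<exists>e\<in>S. a + b + c + 0 + 0 = d + G e"
    using spanning assms S_zero unfolding spanning_set_def by blast
  then show ?thesis by simp
qed

text \<open>Condition (iv) with third summand 0 supplies a preimage in \<open>S\<close>; injectivity
  identifies it with \<open>c\<close>.\<close>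

lemma S_div:
  assumes "a \<in> S" "b \<in> S" "a + b = G c"
  shows "c \<in> S"
proof -
  have "a + b + 0 \<in> range G \<longrightarrow> a + b + 0 \<in> G ` S"
    using spanning assms S_zero unfolding spanning_set_def by blast
  with assms inj show ?thesis
    by (auto simp: inj_eq)
qed

lemma V_finite: "finite (V n)"
  using spanning by (simp add: values_of_length_def finite_lists_length_eq spanning_set_def)

lemma V_covers: "\<exists>n. a \<in> V n"
proof -
  obtain \<sigma> where "\<sigma> \<in> lists S" "a = string_value G \<sigma>"
    using spanning unfolding spanning_set_def by blast
  then have "a \<in> V (length \<sigma>)" by (auto simp: values_of_length_def)
  then show ?thesis ..
qed

text \<open>Zeros can be appended after the last digit because \<open>G 0 = 0\<close>.\<close>

lemma V_mono:
  assumes "m \<le> n"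
  shows "V m \<subseteq> V n"
proof -
  have "V k \<subseteq> V (Suc k)" for k
  proof (induction k)
    case 0
    then show ?case using S_zero zero by (force simp: values_of_length_Suc[OF additive])
  next
    case (Suc k)
    show ?case
    proof
      fix a assume "a \<in> V (Suc k)"
      then obtain s u where "s \<in> S" "u \<in> V k" "a = s + G u"
        by (auto simp: values_of_length_Suc[OF additive])
      with Suc.IH show "a \<in> V (Suc (Suc k))"
        unfolding values_of_length_Suc[OF additive, of _ _ "Suc k"] by blast
    qed
  qed
  then show ?thesis using lift_Suc_mono_le[of V, OF _ assms] by blast
qed

lemma V_uminus: "a \<in> V n \<Longrightarrow> - a \<in> V n"
proof (induction n arbitrary: a)
  case (Suc n)
  then obtain s u where "s \<in> S" "u \<in> V n" "a = s + G u"
    by (auto simp: values_of_length_Suc[OF additive])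
  moreover from this have "- a = - s + G (- u)" by (simp add: minus)
  ultimately show ?case
    using Suc.IH[of u] S_uminus[of s] unfolding values_of_length_Suc[OF additive] by blast
qed simp

lemma V_apply: "a \<in> V n \<Longrightarrow> G a \<in> V (Suc n)"
  using S_zero by (force simp: values_of_length_Suc[OF additive])

text \<open>Column addition, lowest digit first. The carry \<open>c\<close> is part of the statement
  so that the outgoing carry can be passed to the induction hypothesis; the last carry becomes the
  additional digit.\<close>

lemma V_add_carry: "\<lbrakk>u \<in> V n; v \<in> V n; c \<in> S\<rbrakk> \<Longrightarrow> c + u + v \<in> V (Suc n)"
proof (induction n arbitrary: u v c)
  case 0
  then show ?case using zero by (force simp: values_of_length_Suc[OF additive])
next
  case (Suc n)
  obtain s u' where u: "s \<in> S" "u' \<in> V n" "u = s + G u'"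
    using Suc.prems(1) by (auto simp: values_of_length_Suc[OF additive])
  obtain t v' where v: "t \<in> S" "v' \<in> V n" "v = t + G v'"
    using Suc.prems(2) by (auto simp: values_of_length_Suc[OF additive])
  obtain d e where de: "d \<in> S" "e \<in> S" "c + s + t = d + G e"
    using S_add3[OF Suc.prems(3) u(1) v(1)] by blast
  have "c + u + v = (c + s + t) + G (u' + v')"
    by (simp add: u v add algebra_simps)
  also have "\<dots> = d + G (e + u' + v')"
    unfolding de by (simp add: add add.assoc)
  finally show ?case
    using Suc.IH[OF u(2) v(2) de(2)] de(1)
    by (auto simp: values_of_length_Suc[OF additive, of _ _ "Suc n"])
qed

lemma V_zero: "0 \<in> V n"
  using V_mono[of 0 n] by auto

lemma V_add:
  assumes "u \<in> V m" "v \<in> V n"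
  shows "u + v \<in> V (Suc (max m n))"
proof -
  have "0 + u + v \<in> V (Suc (max m n))"
    using assms V_mono[of m "max m n"] V_mono[of n "max m n"] S_zero
    by (intro V_add_carry) auto
  then show ?thesis by simp
qed

text \<open>The subtraction \<open>m - n\<close> may truncate: strings can be padded with zeros.\<close>

lemma V_div_carry:
  assumes "(G ^^ n) a = t + v" "t \<in> S" "v \<in> V m"
  shows "\<exists>t'\<in>S. \<exists>v'\<in>V (m - n). a = t' + v'"
  using assms
proof (induction n arbitrary: t v m)
  case 0
  then show ?case by auto
next
  case (Suc n)
  \<comment> \<open>For \<open>m = 0\<close> the truncated \<open>m - 1\<close> is again 0, and
    \<open>v = 0\<close> is read as the digit 0 followed by 0.\<close>
  obtain s w where w: "s \<in> S" "w \<in> V (m - 1)" "v = s + G w"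
  proof (cases m)
    case 0
    then show ?thesis using Suc.prems that[of 0 0] S_zero zero by simp
  next
    case (Suc k)
    then show ?thesis using \<open>v \<in> V m\<close> that by (auto simp: values_of_length_Suc[OF additive])
  qed
  \<comment> \<open>The carry into the next position: cancelling \<open>G w\<close> leaves
    \<open>G ?t = t + s\<close>, so condition (iv) keeps \<open>?t\<close> in
    \<open>S\<close>.\<close>
  let ?t = "(G ^^ n) a - w"
  have "t + s = G ?t"
    using Suc.prems(1) w(3) by (simp add: diff algebra_simps)
  then have "?t \<in> S"
    using S_div[OF Suc.prems(2) w(1)] by blast
  then show ?case
    using Suc.IH[of ?t w "m - 1"] w(2) by simp
qed

text \<open>The division starts with carry 0. Its final carry is added to the quotient string, which
  costs one digit.\<close>

lemma V_div:
  assumes "(G ^^ n) a \<in> V m"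
  shows "a \<in> V (Suc (m - n))"
proof -
  obtain t v where "t \<in> S" "v \<in> V (m - n)" "a = t + v"
    using V_div_carry[of n a 0 "(G ^^ n) a" m] assms S_zero by auto
  then show ?thesis
    using V_add_carry[OF _ V_zero] by force
qed

definition string_length :: "'a \<Rightarrow> nat" where
  "string_length a = (LEAST n. a \<in> V n)"

lemma string_length_in: "a \<in> V (string_length a)"
  unfolding string_length_def using V_covers by (rule LeastI_ex)

lemma string_length_le_iff: "string_length a \<le> n \<longleftrightarrow> a \<in> V n"
  using string_length_in V_mono by (auto simp: string_length_def intro: Least_le)

text \<open>Exponentiation turns the one extra digit in addition, application of \<open>G\<close>
  and division into a factor 2, so \<open>D\<close>, \<open>C\<close> and \<open>E\<close> can all
  be 2.\<close>

lemma length_function_string_length: "length_function G (\<lambda>a. 2 ^ string_length a)"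
  unfolding length_function_def
proof (intro conjI allI)
  fix a
  show "(0::real) \<le> 2 ^ string_length a" by simp
  have "string_length (- b) \<le> string_length b" for b
    by (simp add: string_length_le_iff V_uminus string_length_in)
  from this[of a] this[of "- a"]
  show "(2::real) ^ string_length a = 2 ^ string_length (- a)" by simp
next
  have "(2::real) ^ string_length (a + b) \<le> 2 * max (2 ^ string_length a) (2 ^ string_length b)"
    for a b
  proof -
    let ?m = "max (string_length a) (string_length b)"
    have "string_length (a + b) \<le> Suc ?m"
      by (simp add: string_length_le_iff V_add string_length_in)
    then have "(2::real) ^ string_length (a + b) \<le> 2 ^ Suc ?m"
      by (intro power_increasing) auto
    also have "\<dots> = 2 * max (2 ^ string_length a) (2 ^ string_length b)"
      by (simp add: max_def)
    finally show ?thesis .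
  qed
  then show "\<exists>D\<ge>1. \<forall>a b. (2::real) ^ string_length (a + b)
      \<le> D * max (2 ^ string_length a) (2 ^ string_length b)"
    by (intro exI[of _ 2]) simp
next
  fix N :: nat
  have "a \<in> V N" if "(2::real) ^ string_length a \<le> real N" for a
  proof -
    have "real (string_length a) < 2 ^ string_length a" by (rule of_nat_less_two_power)
    with that have "string_length a \<le> N" by linarith
    then show ?thesis by (simp add: string_length_le_iff)
  qed
  then show "finite {a. (2::real) ^ string_length a \<le> real N}"
    by (intro finite_subset[OF _ V_finite[of N]]) auto
next
  have up: "(2::real) ^ string_length (G a) \<le> 2 * 2 ^ string_length a" for a
  proof -
    have "string_length (G a) \<le> Suc (string_length a)"
      by (simp add: string_length_le_iff V_apply string_length_in)
    then have "(2::real) ^ string_length (G a) \<le> 2 ^ Suc (string_length a)"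
      by (intro power_increasing) auto
    then show ?thesis by simp
  qed
  have low: "2 ^ n / 2 * (2::real) ^ string_length a \<le> 2 ^ string_length ((G ^^ n) a)"
    if "a \<notin> V 1" for a n
  proof -
    let ?m = "string_length ((G ^^ n) a)"
    have *: "a \<in> V (Suc (?m - n))"
      by (rule V_div[OF string_length_in])
    \<comment> \<open>If \<open>n \<ge> ?m\<close>, the truncated difference is 0 and
      \<open>a\<close> lies in \<open>V 1\<close>. This is why \<open>V 1\<close> serves as the
      exceptional set.\<close>
    with that have "n < ?m"
      by (cases "?m - n") auto
    moreover have "string_length a \<le> Suc (?m - n)"
      using * by (simp add: string_length_le_iff)
    ultimately have "n + string_length a \<le> Suc ?m" by simp
    then have "(2::real) ^ (n + string_length a) \<le> 2 ^ Suc ?m"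
      by (intro power_increasing) auto
    then show ?thesis by (simp add: power_add)
  qed
  show "\<exists>A C E. finite A \<and> C > (1::real) \<and> E \<ge> 1 \<and>
      (\<forall>a. 2 ^ string_length (G a) \<le> C * 2 ^ string_length a) \<and>
      (\<forall>a. a \<notin> A \<longrightarrow> (\<forall>n. 2 ^ string_length ((G ^^ n) a) \<ge> C ^ n / E * 2 ^ string_length a))"
    using up low V_finite[of 1] by (intro exI[of _ "V 1"] exI[of _ 2]) auto
qed

end

section \<open>From length functions to height functions\<close>

lemma height_function_funpow_if_length_function:
  assumes "length_function G l"
  shows "\<exists>m>0. height_function (G ^^ m) l"
proof -
  obtain D where D: "D \<ge> 1" "\<And>a b. l (a + b) \<le> D * max (l a) (l b)"
    using assms by (auto simp: length_function_def)
  obtain A C E where ACE: "finite A" "C > 1" "E \<ge> 1"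
      "\<And>a n. a \<notin> A \<Longrightarrow> l ((G ^^ n) a) \<ge> C ^ n / E * l a"
    using assms unfolding length_function_def by blast
  have nonneg: "0 \<le> l a" and sym: "l (- a) = l a" and fin: "finite {a. l a \<le> real N}" for a N
    using assms by (auto simp: length_function_def)
  \<comment> \<open>Outside \<open>A\<close>, the \<open>m\<close>-th power then multiplies
    \<open>l\<close> by at least \<open>C ^ m / E > 2\<close>, so \<beta> can be 2.\<close>
  obtain m where m: "2 * E < C ^ m"
    using real_arch_pow ACE(2) by blast
  then have "m > 0" using ACE(3) by (cases m) auto
  moreover have "height_function (G ^^ m) l"
    unfolding height_function_def
  proof (intro conjI allI)
    \<comment> \<open>The factor is \<open>D + 1\<close> because \<open>D\<close> may equal 1,
      whereas \<alpha> must exceed 1.\<close>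
    have "l (- a) \<le> (D + 1) * l a + 1" for a
      using sym[of a] mult_nonneg_nonneg[of D "l a"] nonneg[of a] D(1) by (simp add: algebra_simps)
    moreover have "l (a + b) \<le> (D + 1) * (l a + l b) + 1" for a b
    proof -
      have "D * max (l a) (l b) \<le> (D + 1) * (l a + l b)"
        using nonneg[of a] nonneg[of b] D(1) by (intro mult_mono) auto
      then show ?thesis using D(2)[of a b] by linarith
    qed
    ultimately show "\<exists>\<alpha>>1. \<exists>\<kappa>>0. (\<forall>a. l (- a) \<le> \<alpha> * l a + \<kappa>) \<and>
        (\<forall>a b. l (a + b) \<le> \<alpha> * (l a + l b) + \<kappa>)"
      using D(1) by (intro exI[of _ "D + 1"] exI[of _ 1] conjI) auto
    \<comment> \<open>Strictness requires \<open>l a > 0\<close>, so the finite zero set of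
      \<open>l\<close> joins the exceptional set.\<close>
    have "2 * l a < l ((G ^^ m) a)" if "a \<notin> A" "\<not> l a \<le> real 0" for a
    proof -
      have "2 < C ^ m / E" using m ACE(3) by (simp add: field_simps)
      then have "2 * l a < C ^ m / E * l a" using that(2) by (intro mult_strict_right_mono) auto
      then show ?thesis using ACE(4)[OF that(1), of m] by linarith
    qed
    then have "{a. \<not> l ((G ^^ m) a) > 2 * l a} \<subseteq> A \<union> {a. l a \<le> real 0}" by blast
    then show "\<exists>\<beta>>1. finite {a. \<not> l ((G ^^ m) a) > \<beta> * l a}"
      using ACE(1) fin[of 0] by (intro exI[of _ 2]) (auto intro: finite_subset)
  qed (use nonneg fin in auto)
  ultimately show ?thesis by blast
qed

section \<open>From height functions to spanning sets: coset representatives and sublevel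
  sets\<close>

lemma finite_coset_representatives:
  fixes F :: "'a::ab_group_add \<Rightarrow> 'a"
  assumes "additive F" and fin: "finite (UNIV // {(a, b). a - b \<in> range F})"
  shows "\<exists>R. finite R \<and> (\<forall>a. \<exists>r\<in>R. \<exists>b. a = r + F b)"
proof -
  interpret additive F by fact
  let ?rel = "{(a, b). a - b \<in> range F}"
  define rep where "rep X = (SOME b. b \<in> X)" for X :: "'a set"
  have "\<exists>b. a = rep (?rel `` {a}) + F b" for a
  proof -
    have "a - a \<in> range F" using zero by (metis diff_self rangeI)
    then have "a \<in> ?rel `` {a}" by blast
    then have "rep (?rel `` {a}) \<in> ?rel `` {a}"
      unfolding rep_def by (rule someI)
    then obtain b where "a - rep (?rel `` {a}) = F b" by auto
    then have "a = rep (?rel `` {a}) + F b" by (simp add: algebra_simps)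
    then show ?thesis ..
  qed
  moreover have "?rel `` {a} \<in> UNIV // ?rel" for a by (rule quotientI) simp
  ultimately show ?thesis
    using fin by (intro exI[of _ "rep ` (UNIV // ?rel)"]) blast
qed

text \<open>Substituting \<open>b = r' + (F ^^ k) c\<close> into \<open>a = r + F b\<close> shows
  that the elements \<open>r + F r'\<close> represent the cosets for the next power.\<close>

lemma finite_coset_representatives_funpow:
  fixes F :: "'a::ab_group_add \<Rightarrow> 'a"
  assumes "additive F" and fin: "finite R" and R: "\<And>a. \<exists>r\<in>R. \<exists>b. a = r + F b"
  shows "\<exists>R'. finite R' \<and> (\<forall>a. \<exists>r\<in>R'. \<exists>b. a = r + (F ^^ k) b)"
proof (induction k)
  case 0
  show ?case by (intro exI[of _ "{0}"]) simp
next
  case (Suc k)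
  interpret additive F by fact
  obtain R' where R': "finite R'" "\<And>a. \<exists>r\<in>R'. \<exists>b. a = r + (F ^^ k) b" using Suc by blast
  let ?R = "(\<lambda>(r, r'). r + F r') ` (R \<times> R')"
  have "\<exists>s\<in>?R. \<exists>c. a = s + (F ^^ Suc k) c" for a
  proof -
    obtain r b where r: "r \<in> R" "a = r + F b" using R by blast
    obtain r' c where r': "r' \<in> R'" "b = r' + (F ^^ k) c" using R'(2) by blast
    have "a = (r + F r') + (F ^^ Suc k) c" by (simp add: r r' add algebra_simps)
    moreover have "r + F r' \<in> ?R" using r(1) r'(1) by force
    ultimately show ?thesis by blast
  qed
  then show ?case using fin R'(1) by (intro exI[of _ ?R]) auto
qed

text \<open>Expansion can fail at step \<open>Suc m\<close> only where it fails at step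
  \<open>m\<close> or where \<open>(G ^^ m) a\<close> is exceptional for \<open>G\<close>;
  injectivity keeps the latter set finite. The inequality is weak because \<open>m = 0\<close> gives
  equality.\<close>

lemma finite_not_expanding_funpow:
  fixes h :: "'a \<Rightarrow> real"
  assumes "inj G" "\<beta> > 1" and fin: "finite {a. \<not> h (G a) > \<beta> * h a}"
  shows "finite {a. \<not> h ((G ^^ m) a) \<ge> \<beta> ^ m * h a}"
proof (induction m)
  case (Suc m)
  have "\<beta> ^ Suc m * h a \<le> h ((G ^^ Suc m) a)"
    if "\<beta> ^ m * h a \<le> h ((G ^^ m) a)" "\<beta> * h ((G ^^ m) a) < h (G ((G ^^ m) a))" for a
  proof -
    have "\<beta> * (\<beta> ^ m * h a) \<le> \<beta> * h ((G ^^ m) a)"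
      using that(1) \<open>\<beta> > 1\<close> by (intro mult_left_mono) auto
    with that(2) show ?thesis by (simp add: mult.assoc)
  qed
  then have "{a. \<not> h ((G ^^ Suc m) a) \<ge> \<beta> ^ Suc m * h a}
      \<subseteq> {a. \<not> h ((G ^^ m) a) \<ge> \<beta> ^ m * h a} \<union> (G ^^ m) -` {a. \<not> h (G a) > \<beta> * h a}"
    by (auto simp del: power_Suc funpow.simps)
  moreover have "finite ((G ^^ m) -` {a. \<not> h (G a) > \<beta> * h a})"
    using fin inj_fn[OF \<open>inj G\<close>] by (rule finite_vimageI)
  ultimately show ?case
    using Suc.IH by (meson finite_Un finite_subset)
qed simp

text \<open>
  A sum of five elements of the sublevel set, corrected by a coset representative, has height at
  most \<open>K ^ 5 * N\<close>.  The additional factor \<open>2\<close> makes the digit expansion of every element terminate.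
\<close>

lemma spanning_set_sublevel:
  fixes H :: "'a::ab_group_add \<Rightarrow> 'a" and g :: "'a \<Rightarrow> real"
  assumes "additive H"
    and sym: "\<And>a. g (- a) = g a" and nonneg: "\<And>a. 0 \<le> g a"
    and K: "1 \<le> K" and N: "0 < N"
    and triangle: "\<And>a b M. \<lbrakk>N \<le> M; g a \<le> M; g b \<le> M\<rbrakk> \<Longrightarrow> g (a + b) \<le> K * M"
    and fin: "finite {a. g a \<le> N}"
    and R: "\<And>a. \<exists>r b. g r \<le> N \<and> a = r + H b"
    and expand: "\<And>a. N < g a \<Longrightarrow> 2 * K ^ 5 * g a \<le> g (H a)"
  shows "spanning_set H {a. g a \<le> N}"
proof -
  interpret additive H by fact
  \<comment> \<open>Otherwise expansion at the fixed point 0 would force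
    \<open>2 * K ^ 5 \<le> 1\<close>.\<close>
  have zero_in: "g 0 \<le> N"
  proof (rule ccontr)
    assume "\<not> g 0 \<le> N"
    then have "2 * K ^ 5 * g 0 \<le> 1 * g 0" "0 < g 0" using expand[of 0] N by (auto simp: zero)
    then have "2 * K ^ 5 \<le> 1" by (meson mult_le_cancel_right_pos)
    then show False using one_le_power[OF K, of 5] by linarith
  qed
  have diff_bound: "g (a - b) \<le> K * M" if "N \<le> M" "g a \<le> M" "g b \<le> M" for a b M
    using triangle[of M a "- b"] that by (simp add: sym)
  \<comment> \<open>Undoing \<open>H\<close> lands in the sublevel set or halves the bound
    \<open>M\<close>. For \<open>M = N\<close> the result is always in the sublevel set.\<close>
  have divide: "g b \<le> max N (M / 2)" if "g (H b) \<le> K ^ 5 * M" for b M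
  proof (cases "g b \<le> N")
    case False
    then have "K ^ 5 * (2 * g b) \<le> K ^ 5 * M"
      using expand[of b] that by (simp add: mult_ac)
    then have "2 * g b \<le> M" using K by (simp add: mult_le_cancel_left_pos)
    then show ?thesis by simp
  qed simp
  have pow_mono: "K ^ i * M \<le> K ^ j * M" if "i \<le> j" "0 \<le> M" for i j M
    using that K by (intro mult_right_mono power_increasing) auto
  have N_pow: "N \<le> K ^ i * N" for i
    using pow_mono[of 0 i N] N by simp
  have add_pow: "g (a + b) \<le> K ^ Suc i * N" if "g a \<le> K ^ i * N" "g b \<le> N" for a b i
    using triangle[OF N_pow that(1), of b] that(2) N_pow[of i] by (simp add: mult.assoc)
  have sum3: "g (a + b + c) \<le> K ^ 2 * N" if "g a \<le> N" "g b \<le> N" "g c \<le> N" for a b c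
    using add_pow[of "a + b" 1 c] add_pow[of a 0 b] that by (simp add: numeral_2_eq_2)
  have sum5: "g (a + b + c + d + e) \<le> K ^ 4 * N"
    if "g a \<le> N" "g b \<le> N" "g c \<le> N" "g d \<le> N" "g e \<le> N" for a b c d e
    using add_pow[of "a + b + c + d" 3 e] add_pow[of "a + b + c" 2 d] sum3[of a b c] that
    by (simp add: eval_nat_numeral)
  \<comment> \<open>Induction on the number of halvings: removing a representative as first digit
    and undoing \<open>H\<close> lowers the bound from \<open>2 ^ Suc k * N\<close> to
    \<open>2 ^ k * N\<close>.\<close>
  have string: "\<exists>\<sigma>\<in>lists {a. g a \<le> N}. a = string_value H \<sigma>" if "g a \<le> 2 ^ k * N" for a k
    using that
  proof (induction k arbitrary: a)
    case 0
    then show ?case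
      by (intro bexI[of _ "[a]"]) (auto simp: string_value_Cons[OF \<open>additive H\<close>] zero)
  next
    case (Suc k)
    obtain r b where r: "g r \<le> N" "a = r + H b" using R by blast
    let ?M = "2 ^ Suc k * N"
    have NM: "N \<le> ?M" using N mult_right_mono[of 1 "2 ^ Suc k" N] one_le_power[of "2::real" "Suc k"] by simp
    then have "g (H b) \<le> K * ?M" using diff_bound[OF NM Suc.prems, of r] r by simp
    also have "\<dots> \<le> K ^ 5 * ?M" using pow_mono[of 1 5 ?M] N by simp
    finally have "g b \<le> max N (?M / 2)" by (rule divide)
    also have "\<dots> \<le> 2 ^ k * N" using N mult_right_mono[of 1 "2 ^ k" N] by simp
    finally obtain \<sigma> where "\<sigma> \<in> lists {a. g a \<le> N}" "b = string_value H \<sigma>" using Suc.IH by blast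
    then show ?case
      using r by (intro bexI[of _ "r # \<sigma>"]) (auto simp: string_value_Cons[OF \<open>additive H\<close>])
  qed
  have all_strings: "\<exists>\<sigma>\<in>lists {a. g a \<le> N}. a = string_value H \<sigma>" for a
  proof -
    obtain k :: nat where "g a / N < 2 ^ k" using real_arch_pow[of 2 "g a / N"] by auto
    then have "g a \<le> 2 ^ k * N" using N by (simp add: field_simps)
    then show ?thesis by (rule string)
  qed
  have carry: "\<exists>b\<in>{a. g a \<le> N}. \<exists>c\<in>{a. g a \<le> N}. a1 + a2 + a3 + a4 + a5 = b + H c"
    if "g a1 \<le> N" "g a2 \<le> N" "g a3 \<le> N" "g a4 \<le> N" "g a5 \<le> N" for a1 a2 a3 a4 a5
  proof -
    obtain r b where r: "g r \<le> N" "a1 + a2 + a3 + a4 + a5 = r + H b" using R by blast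
    \<comment> \<open>Four additions and the subtraction of \<open>r\<close> cost one factor
      \<open>K\<close> each, which accounts for the exponent 5.\<close>
    have "g (a1 + a2 + a3 + a4 + a5 + - r) \<le> K ^ Suc 4 * N"
      using sum5[OF that] r(1) by (intro add_pow) (auto simp: sym)
    then have "g (H b) \<le> K ^ 5 * N" by (simp add: r)
    from divide[OF this] have "g b \<le> N" using N by simp
    with r show ?thesis by blast
  qed
  have div: "a1 + a2 + a3 \<in> H ` {a. g a \<le> N}"
    if S: "g a1 \<le> N" "g a2 \<le> N" "g a3 \<le> N" and range: "a1 + a2 + a3 \<in> range H" for a1 a2 a3
  proof -
    obtain b where b: "a1 + a2 + a3 = H b" using range by blast
    have "g (H b) \<le> K ^ 5 * N"
      using sum3[OF S] pow_mono[of 2 5 N] N unfolding b by linarith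
    from divide[OF this] have "g b \<le> N" using N by simp
    with b show ?thesis by blast
  qed
  show ?thesis
    unfolding spanning_set_def
    using fin all_strings zero_in sym carry div by simp
qed

lemma spanning_set_funpow_if_height_function:
  fixes G :: "'a::ab_group_add \<Rightarrow> 'a"
  assumes "additive G" "inj G" and height: "height_function G h"
    and "finite R" and R: "\<And>a. \<exists>r\<in>R. \<exists>b. a = r + G b"
  shows "\<exists>m>0. \<exists>S. spanning_set (G ^^ m) S"
proof -
  obtain \<alpha> \<kappa> where \<alpha>: "\<alpha> > 1" "\<kappa> > 0" "\<And>a b. h (a + b) \<le> \<alpha> * (h a + h b) + \<kappa>"
    using height by (auto simp: height_function_def)
  have nonneg: "0 \<le> h a" for a using height by (simp add: height_function_def)
  have fin: "finite {a. h a \<le> real N}" for N using height by (simp add: height_function_def)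
  obtain \<beta> where \<beta>: "\<beta> > 1" "finite {a. \<not> h (G a) > \<beta> * h a}"
    using height by (auto simp: height_function_def)
  \<comment> \<open>Symmetrization: the sublevel sets must be closed under negation, while
    \<open>h\<close> itself need not be even.\<close>
  define g where "g a = h a + h (- a)" for a
  have sym: "g (- a) = g a" for a by (simp add: g_def)
  have g_nonneg: "0 \<le> g a" for a using nonneg by (simp add: g_def add_nonneg_nonneg)
  have g_add: "g (a + b) \<le> \<alpha> * (g a + g b) + 2 * \<kappa>" for a b
    using \<alpha>(3)[of a b] \<alpha>(3)[of "- a" "- b"] by (simp add: g_def algebra_simps)
  \<comment> \<open>Once \<open>\<kappa> \<le> M\<close>, the bound
    \<open>\<alpha> * (2 * M) + 2 * \<kappa>\<close> is at most \<open>K * M\<close>, which removes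
    the additive constant.\<close>
  define K where "K = 2 * \<alpha> + 2"
  obtain m where m: "2 * K ^ 5 < \<beta> ^ m" using real_arch_pow[OF \<beta>(1)] by blast
  have "1 \<le> K" using \<alpha>(1) by (simp add: K_def)
  then have "1 \<le> 2 * K ^ 5" using one_le_power[of K 5] by linarith
  then have "m > 0" using m by (cases m) auto
  define X where "X = {a. \<not> h ((G ^^ m) a) \<ge> \<beta> ^ m * h a}"
  have "finite X" unfolding X_def by (rule finite_not_expanding_funpow[OF \<open>inj G\<close> \<beta>])
  have G_uminus: "(G ^^ m) (- a) = - (G ^^ m) a" for a
    by (rule additive.minus[OF additive_funpow[OF \<open>additive G\<close>]])
  \<comment> \<open>Expansion of \<open>g\<close> at \<open>a\<close> combines expansion of
    \<open>h\<close> at \<open>a\<close> and at \<open>- a\<close>, so both must avoid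
    \<open>X\<close>.\<close>
  have g_expand: "\<beta> ^ m * g a \<le> g ((G ^^ m) a)" if "a \<notin> X \<union> uminus ` X" for a
  proof -
    have "a \<notin> X" "- a \<notin> X" using that by (auto simp: image_iff)
    with G_uminus show ?thesis
      by (simp add: X_def g_def distrib_left add_mono)
  qed
  obtain R' where R': "finite R'" "\<And>a. \<exists>r\<in>R'. \<exists>b. a = r + (G ^^ m) b"
    using finite_coset_representatives_funpow[OF \<open>additive G\<close> \<open>finite R\<close> R] by blast
  let ?B = "R' \<union> X \<union> uminus ` X"
  have "finite ?B" using R'(1) \<open>finite X\<close> by simp
  then obtain N0 where N0: "\<And>a. a \<in> ?B \<Longrightarrow> g a \<le> N0"
    using bdd_above_finite[of "g ` ?B"] by (auto simp: bdd_above_def)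
  \<comment> \<open>\<open>N\<close> dominates \<open>g\<close> on all representatives and
    exceptional elements. The maximum ensures \<open>N \<ge> \<kappa> > 0\<close> whatever the sign
    of \<open>N0\<close>.\<close>
  define N where "N = max (N0 + \<kappa>) \<kappa>"
  have "spanning_set (G ^^ m) {a. g a \<le> N}"
  proof (rule spanning_set_sublevel[where K = K])
    show "additive (G ^^ m)" by (rule additive_funpow) fact
    show "1 \<le> K" "0 < N" using \<alpha> by (auto simp: K_def N_def)
    show "g (a + b) \<le> K * M" if "N \<le> M" "g a \<le> M" "g b \<le> M" for a b M
    proof -
      have "\<alpha> * (g a + g b) \<le> \<alpha> * (2 * M)" using that \<alpha>(1) by (intro mult_left_mono) auto
      moreover have "\<kappa> \<le> M" using that by (simp add: N_def)
      ultimately show ?thesis using g_add[of a b] by (simp add: K_def algebra_simps)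
    qed
    obtain n :: nat where n: "N \<le> real n" using real_arch_simple by blast
    have "h a \<le> real n" if "g a \<le> N" for a using nonneg[of "- a"] n that by (simp add: g_def)
    then have "{a. g a \<le> N} \<subseteq> {a. h a \<le> real n}" by blast
    then show "finite {a. g a \<le> N}" using fin by (rule finite_subset)
    show "\<exists>r b. g r \<le> N \<and> a = r + (G ^^ m) b" for a
    proof -
      obtain r b where r: "r \<in> R'" "a = r + (G ^^ m) b" using R'(2) by blast
      then have "g r \<le> N" using N0[of r] \<alpha>(2) by (simp add: N_def)
      with r show ?thesis by blast
    qed
    show "2 * K ^ 5 * g a \<le> g ((G ^^ m) a)" if "N < g a" for a
    proof -
      have "a \<notin> X \<union> uminus ` X" using that N0[of a] \<alpha>(2) by (auto simp: N_def)
      from g_expand[OF this] show ?thesis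
        using m mult_right_mono[OF less_imp_le[OF m] g_nonneg[of a]] by linarith
    qed
  qed (simp_all add: sym g_nonneg)
  with \<open>m > 0\<close> show ?thesis by blast
qed

theorem theorem3p9:
  fixes F :: "'a::ab_group_add \<Rightarrow> 'a"
  assumes "infinite (UNIV :: 'a set)"
    and "additive F"
    and "inj F"
    and "finite (UNIV // {(a, b). a - b \<in> range F})"
  shows "((\<exists>r::nat. r > 0 \<and> (\<exists>S. spanning_set (F ^^ r) S)) \<longleftrightarrow>
          (\<exists>r::nat. r > 0 \<and> (\<exists>l. length_function (F ^^ r) l))) \<and>
         ((\<exists>r::nat. r > 0 \<and> (\<exists>l. length_function (F ^^ r) l)) \<longleftrightarrow>
          (\<exists>r::nat. r > 0 \<and> (\<exists>h. height_function (F ^^ r) h)))"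
proof -
  have add: "additive (F ^^ r)" and inj: "inj (F ^^ r)" for r
    using additive_funpow assms(2) inj_fn assms(3) by auto
  have 1: "\<exists>l. length_function (F ^^ r) l" if "spanning_set (F ^^ r) S" for r S
    using length_function_string_length[OF add inj that] by blast
  \<comment> \<open>A positive power of \<open>F ^^ r\<close> is again a positive power of
    \<open>F\<close>, so the exponents multiply.\<close>
  have 2: "\<exists>s>0. \<exists>h. height_function (F ^^ s) h"
    if "r > 0" "length_function (F ^^ r) l" for r l
    using height_function_funpow_if_length_function[OF that(2)] that(1)
    by (metis funpow_mult nat_0_less_mult_iff)
  have 3: "\<exists>s>0. \<exists>S. spanning_set (F ^^ s) S"
    if "r > 0" "height_function (F ^^ r) h" for r h
  proof -
    \<comment> \<open>Finiteness of the quotient is given for \<open>F\<close> only and is carried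
      over to \<open>F ^^ r\<close> through representatives.\<close>
    obtain R where "finite R" "\<And>a. \<exists>r\<in>R. \<exists>b. a = r + F b"
      using finite_coset_representatives[OF assms(2,4)] by blast
    from finite_coset_representatives_funpow[OF assms(2) this]
    obtain R' where "finite R'" "\<And>a. \<exists>s\<in>R'. \<exists>b. a = s + (F ^^ r) b" by blast
    from spanning_set_funpow_if_height_function[OF add inj that(2) this] that(1)
    show ?thesis by (metis funpow_mult nat_0_less_mult_iff)
  qed
  show ?thesis
    using 1 2 3 by (intro conjI iffI; elim exE conjE) metis+
qed

end
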